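(* For each integer $b \ge 2$ there holds $$\nu_b(\overline{G}_n) = \nu_b^{\ast}(\overline{G}_n) \quad \text{for all integers } n \ge 1.$$
   Context: Let $b \ge 2$ and $n \ge 1$ be integers. For an integer $m \ge 0$, $d_b(m)$ is the sum of the digits of $m$ in its base $b$ expansion (so $d_b(0)=0$), and $S_b(n) := \sum_{j=0}^{n-1} d_b(j)$. Define $$\nu_b(\overline{G}_n) := \frac{1}{b-1}\Big(2 S_b(n) - (n-1)\, d_b(n)\Big).$$ Writing $n = \sum_{j=0}^k a_j b^j$ for the base $b$ expansion of $n$ (digits $0 \le a_j \le b-1$, $a_k \ne 0$), define $$\nu_b^{\ast}(\overline{G}_n) := \sum_{j=1}^k j a_j b^j - \left( \sum_{j=1}^k a_j \left(\frac{b^j-1}{b-1}\right) + \sum_{j=0}^k \frac{1}{b^{j+1}} \Big(\sum_{u=0}^j a_u b^u\Big)\Big(\sum_{v=j+1}^k a_v b^v\Big)\right).$$ Empty sums are $0$. Here $\overline{G}_n := \prod_{t=0}^n\binom{n}{t}$, but $\nu_b(\overline{G}_n)$ denotes only the function of $b$ and $n$ given by $\frac{1}{b-1}\big(2 S_b(n) - (n-1)\, d_b(n)\big)$, and $\nu_b^{\ast}(\overline{G}_n)$ denotes only the function of $b$ and $n$ given by $\sum_{j=1}^k j a_j b^j - \big( \sum_{j=1}^k a_j \frac{b^j-1}{b-1} + \sum_{j=0}^k \frac{1}{b^{j+1}} (\sum_{u=0}^j a_u b^u)(\sum_{v=j+1}^k a_v b^v)\big)$. *)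

theory Defs
  imports "HOL-Library.Log_Nat"
begin

definition base_digit :: "nat \<Rightarrow> nat \<Rightarrow> nat \<Rightarrow> nat" where
  "base_digit b m j = m div b ^ j mod b"

text \<open>The index \<open>k\<close> of the leading digit of a positive number: \<^term>\<open>floorlog b m\<close> is
  the number of base \<open>b\<close> digits of \<open>m\<close>.\<close>

definition lead_index :: "nat \<Rightarrow> nat \<Rightarrow> nat" where
  "lead_index b m = floorlog b m - 1"

text \<open>The digit sum \<open>d\<^sub>b(m)\<close>; the sum is empty for \<open>m = 0\<close>.\<close>

definition digit_sum :: "nat \<Rightarrow> nat \<Rightarrow> nat" where
  "digit_sum b m = (\<Sum>j<floorlog b m. base_digit b m j)"

definition sum_digit_sums :: "nat \<Rightarrow> nat \<Rightarrow> nat" where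
  "sum_digit_sums b n = (\<Sum>j<n. digit_sum b j)"

definition nu :: "nat \<Rightarrow> nat \<Rightarrow> real" where
  "nu b n = 1 / (real b - 1) *
     (2 * real (sum_digit_sums b n) - (real n - 1) * real (digit_sum b n))"

definition nu_star :: "nat \<Rightarrow> nat \<Rightarrow> real" where
  "nu_star b n =
     (let k = lead_index b n; a = (\<lambda>j. real (base_digit b n j)); B = real b in
        (\<Sum>j=1..k. real j * a j * B ^ j) -
        ((\<Sum>j=1..k. a j * ((B ^ j - 1) / (B - 1))) +
         (\<Sum>j=0..k. 1 / B ^ (j + 1) *
            (\<Sum>u=0..j. a u * B ^ u) * (\<Sum>v=j+1..k. a v * B ^ v))))"

text \<open>The next lemmas show that \<^const>\<open>base_digit\<close> and \<^const>\<open>lead_index\<close> give the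
  base \<open>b\<close> expansion of \<open>n\<close>, and that this expansion is unique.\<close>

lemma base_digit_less: "b \<ge> 2 \<Longrightarrow> base_digit b m j < b"
  by (simp add: base_digit_def)

lemma sum_base_digits_lessThan:
  "(\<Sum>j<l. base_digit b n j * b ^ j) = n mod b ^ l"
proof (induction l)
  case (Suc l)
  have "n mod b ^ Suc l = b ^ l * (n div b ^ l mod b) + n mod b ^ l"
    using mod_mult2_eq[of n "b ^ l" b] by (simp add: mult.commute)
  with Suc show ?case by (simp add: base_digit_def)
qed simp

lemma base_expansion:
  assumes "b \<ge> 2" "n \<ge> 1"
  shows "n = (\<Sum>j=0..lead_index b n. base_digit b n j * b ^ j)"
    and "base_digit b n (lead_index b n) \<noteq> 0"
proof -
  have pos: "floorlog b n > 0" using assms by (simp add: floorlog_def)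
  have bds: "b ^ (floorlog b n - 1) \<le> n" "n < b ^ floorlog b n"
    using floorlog_bounds[of n b] assms by auto
  have "{0..lead_index b n} = {..<floorlog b n}"
    using pos by (auto simp: lead_index_def)
  then show "n = (\<Sum>j=0..lead_index b n. base_digit b n j * b ^ j)"
    using bds by (simp add: sum_base_digits_lessThan)
  have "n < b ^ lead_index b n * b"
    using bds(2) power_minus_mult[OF pos, of b] by (simp only: lead_index_def)
  then have "n div b ^ lead_index b n < b"
    by (simp add: less_mult_imp_div_less mult.commute)
  moreover have "n div b ^ lead_index b n > 0"
    using bds(1) assms by (simp add: lead_index_def div_greater_zero_iff)
  ultimately show "base_digit b n (lead_index b n) \<noteq> 0"
    by (simp add: base_digit_def)
qed

lemma digits_bound:
  fixes a :: "nat \<Rightarrow> nat"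
  assumes "b \<ge> 2" "\<And>j. j < l \<Longrightarrow> a j < b"
  shows "(\<Sum>j<l. a j * b ^ j) < b ^ l"
  using assms(2)
proof (induction l)
  case (Suc l)
  have "(\<Sum>j<l. a j * b ^ j) < b ^ l" using Suc by simp
  moreover have "(a l + 1) * b ^ l \<le> b * b ^ l"
    using Suc.prems[of l] by (intro mult_right_mono) auto
  ultimately show ?case by simp
qed simp

lemma base_expansion_unique:
  fixes a :: "nat \<Rightarrow> nat"
  assumes b: "b \<ge> 2" and n: "n = (\<Sum>j=0..k. a j * b ^ j)"
    and dig: "\<And>j. j \<le> k \<Longrightarrow> a j < b" and lead: "a k \<noteq> 0"
  shows "k = lead_index b n" and "\<And>j. j \<le> k \<Longrightarrow> a j = base_digit b n j"
proof -
  have n': "n = (\<Sum>j<Suc k. a j * b ^ j)"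
    using n by (simp add: atLeast0AtMost lessThan_Suc_atMost)
  have up: "n < b ^ Suc k"
    unfolding n' by (rule digits_bound[OF b]) (simp add: dig)
  have "1 * b ^ k \<le> a k * b ^ k" using lead by (intro mult_right_mono) auto
  then have lo: "b ^ k \<le> n" unfolding n' sum.lessThan_Suc mult_1 by (rule trans_le_add2)
  have npos: "n > 0" using lo b
    by (auto intro: less_le_trans[of 0 "b ^ k"])
  have bds: "b ^ (floorlog b n - 1) \<le> n" "n < b ^ floorlog b n"
    using floorlog_bounds[of n b] b npos by auto
  have "k < floorlog b n"
    using power_less_imp_less_exp[OF _ le_less_trans[OF lo bds(2)]] b by simp
  moreover have "floorlog b n - 1 < Suc k"
    using power_less_imp_less_exp[OF _ le_less_trans[OF bds(1) up]] b by simp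
  ultimately show "k = lead_index b n" by (simp add: lead_index_def)
  fix j assume j: "j \<le> k"
  have mods: "n mod b ^ l = (\<Sum>j<l. a j * b ^ j)" if l: "l \<le> Suc k" for l
  proof -
    let ?lo = "\<Sum>j<l. a j * b ^ j" and ?hi = "\<Sum>j=l..<Suc k. a j * b ^ j"
    have "n = ?lo + ?hi"
      unfolding n' lessThan_atLeast0
      using sum.atLeastLessThan_concat[of 0 l "Suc k" "\<lambda>j. a j * b ^ j"] l by simp
    moreover have "b ^ l dvd ?hi"
      by (intro dvd_sum) (simp add: le_imp_power_dvd)
    then obtain c where "?hi = b ^ l * c" by (elim dvdE)
    ultimately have "n mod b ^ l = ?lo mod b ^ l" by (simp only: mod_mult_self2)
    also have "\<dots> = ?lo"
      by (intro mod_less digits_bound[OF b]) (use l dig in auto)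
    finally show ?thesis .
  qed
  have "n mod b ^ Suc j = n mod b ^ j + a j * b ^ j"
    using mods[of "Suc j"] mods[of j] j by simp
  moreover have "n mod b ^ Suc j = n mod b ^ j + base_digit b n j * b ^ j"
    using sum_base_digits_lessThan[where l="Suc j" and b=b and n=n]
      sum_base_digits_lessThan[where l=j and b=b and n=n] by simp
  ultimately show "a j = base_digit b n j" using b by simp
qed

end

theory Submission
  imports Defs
begin

text \<open>
  Both sides satisfy the same recursion along the base \<open>b\<close> expansion, from \<open>n\<close> to
  \<open>b * n + c\<close> with a new last digit \<open>c < b\<close>. Writing \<open>d\<close> for the digit sum of \<open>n\<close>, either
  function \<open>f\<close> satisfies
  \[ f(bn+c) = b f(n) + bn - d + \frac{c (d - bn)}{b-1}, \]
  and both vanish at \<open>0\<close>, so they agree.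

  For \<open>nu\<close> the recursion comes from grouping the numbers below \<open>b * n + c\<close> by their
  quotient by \<open>b\<close> (\<open>sum_digit_sums_append\<close>). For \<open>nu_star\<close> the key remark is that its
  product terms are
  \[ \frac{1}{b^{j+1}} \Big(\sum_{u \le j} a_u b^u\Big) \Big(\sum_{v > j} a_v b^v\Big)
      = (n \bmod b^{j+1}) \lfloor n / b^{j+1} \rfloor , \]
  so appending \<open>c\<close> multiplies the remainders by \<open>b\<close>, adds \<open>c\<close> to them and keeps the
  quotients. The extra contribution \<open>c * (\<Sum>j. n div b ^ (j + 1))\<close> is evaluated by
  Legendre's formula (\<open>legendre_digit_sum\<close>). To follow the digit shift it is convenient to let
  the sums run up to any length \<open>L\<close> that is large enough (\<open>nu_star_eq\<close>).
\<close>

section \<open>Digits of a number with an appended last digit\<close>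

lemma less_power_Suc_lead_index:
  assumes "b \<ge> 2"
  shows "n < b ^ Suc (lead_index b n)"
proof (cases "n = 0")
  case False
  then have "floorlog b n > 0" using assms by (simp add: floorlog_def)
  then show ?thesis
    using floorlog_bounds[of n b] False assms by (simp add: lead_index_def)
qed (use assms in simp)

lemma floorlog_le_iff_less_power:
  assumes "b \<ge> 2"
  shows "floorlog b n \<le> L \<longleftrightarrow> n < b ^ L"
proof
  assume "floorlog b n \<le> L"
  then have "b ^ floorlog b n \<le> b ^ L" using assms by (simp add: power_increasing)
  moreover have "n < b ^ floorlog b n"
    using floorlog_bounds[of n b] assms by (cases "n = 0") auto
  ultimately show "n < b ^ L" by simp
next
  assume "n < b ^ L"
  then show "floorlog b n \<le> L" using assms by (intro floorlog_leI) auto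
qed

lemma base_digit_eq_0: "n < b ^ j \<Longrightarrow> base_digit b n j = 0"
  by (simp add: base_digit_def)

lemma digit_sum_eq:
  assumes "b \<ge> 2" "n < b ^ L"
  shows "digit_sum b n = (\<Sum>j<L. base_digit b n j)"
  unfolding digit_sum_def
proof (rule sum.mono_neutral_left)
  show "{..<floorlog b n} \<subseteq> {..<L}"
    using assms floorlog_le_iff_less_power by auto
  show "\<forall>i\<in>{..<L} - {..<floorlog b n}. base_digit b n i = 0"
    using assms(1) floorlog_le_iff_less_power by (auto intro!: base_digit_eq_0)
qed simp

lemma base_digit_append_0: "c < b \<Longrightarrow> base_digit b (b * n + c) 0 = c"
  by (simp add: base_digit_def)

lemma div_power_Suc_append:
  fixes b :: nat
  assumes "c < b"
  shows "(b * n + c) div b ^ Suc j = n div b ^ j"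
  using assms by (simp add: div_mult2_eq)

lemma mod_power_Suc_append:
  fixes b :: nat
  assumes "c < b"
  shows "(b * n + c) mod b ^ Suc j = b * (n mod b ^ j) + c"
  using assms by (simp add: mod_mult2_eq)

lemma base_digit_append_Suc:
  "c < b \<Longrightarrow> base_digit b (b * n + c) (Suc j) = base_digit b n j"
  unfolding base_digit_def by (simp only: div_power_Suc_append)

lemma append_less_power_Suc:
  fixes b :: nat
  assumes "c < b" "n < b ^ L"
  shows "b * n + c < b ^ Suc L"
proof -
  have "b * n + c < b * Suc n" using assms(1) by simp
  also have "\<dots> \<le> b * b ^ L" using assms(2) by (intro mult_left_mono) auto
  finally show ?thesis by simp
qed

lemma digit_sum_append:
  assumes "b \<ge> 2" "c < b"
  shows "digit_sum b (b * n + c) = digit_sum b n + c"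
proof -
  have *: "n < b ^ Suc (lead_index b n)" by (rule less_power_Suc_lead_index[OF assms(1)])
  show ?thesis
    unfolding digit_sum_eq[OF assms(1) append_less_power_Suc[OF assms(2) *]]
      digit_sum_eq[OF assms(1) *]
    by (subst sum.lessThan_Suc_shift)
      (simp add: base_digit_append_0 base_digit_append_Suc assms(2))
qed

text \<open>Legendre's formula: each digit is \<open>n div b ^ j - b * (n div b ^ (j + 1))\<close>, so the sum
  of all digits is \<open>n\<close> minus \<open>b - 1\<close> times the sum of the quotients. The induction removes the
  last digit, which replaces \<open>n\<close> by its first quotient.\<close>

lemma legendre_digit_sum:
  assumes "b \<ge> 2" "n < b ^ L"
  shows "(real b - 1) * (\<Sum>j<L. real (n div b ^ Suc j)) = real n - real (digit_sum b n)"
  using assms(2)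
proof (induction L arbitrary: n)
  case 0
  then show ?case by (simp add: digit_sum_def floorlog_def)
next
  case (Suc L)
  define m c where "m = n div b" and "c = n mod b"
  have n: "n = b * m + c" and c: "c < b" using assms(1) by (simp_all add: m_def c_def)
  have m: "m < b ^ L"
    using Suc.prems by (simp add: m_def less_mult_imp_div_less mult.commute)
  have "(\<Sum>j<Suc L. real (n div b ^ Suc j)) = (\<Sum>j<Suc L. real (m div b ^ j))"
    unfolding n div_power_Suc_append[OF c] ..
  also have "\<dots> = real m + (\<Sum>j<L. real (m div b ^ Suc j))"
    by (subst sum.lessThan_Suc_shift) simp
  finally have "(real b - 1) * (\<Sum>j<Suc L. real (n div b ^ Suc j))
      = (real b - 1) * real m + (real m - real (digit_sum b m))"
    by (simp only: distrib_left Suc.IH[OF m])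
  moreover have "real n = real b * real m + real c" by (simp add: n)
  moreover have "real (digit_sum b n) = real (digit_sum b m) + real c"
    by (simp only: n digit_sum_append[OF assms(1) c] of_nat_add)
  ultimately show ?case by (simp only: left_diff_distrib)
qed

section \<open>The recursion for the digit sum side\<close>

lemma sum_digit_sums_Suc: "sum_digit_sums b (Suc n) = sum_digit_sums b n + digit_sum b n"
  by (simp add: sum_digit_sums_def)

lemma sum_digit_sums_append_aux:
  assumes "b \<ge> 2" "c \<le> b"
  shows "2 * real (sum_digit_sums b (b * n + c))
    = 2 * real (sum_digit_sums b (b * n)) + 2 * real c * real (digit_sum b n)
      + real c * (real c - 1)"
  using assms(2)
proof (induction c)
  case (Suc c)
  then have c: "c < b" "c \<le> b" by simp_all
  show ?case
    unfolding add_Suc_right sum_digit_sums_Suc digit_sum_append[OF assms(1) c(1)]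
      of_nat_add distrib_left Suc.IH[OF c(2)]
    by (simp add: algebra_simps)
qed simp

text \<open>The numbers with quotient \<open>m\<close> by \<open>b\<close> contribute \<open>digit_sum b m\<close> each, plus their last
  digits. The bound \<open>c \<le> b\<close> includes \<open>c = b\<close>, where a block is complete; this gives the step
  from \<open>b * n\<close> to \<open>b * (n + 1)\<close>.\<close>

lemma sum_digit_sums_append:
  assumes "b \<ge> 2" "c \<le> b"
  shows "2 * real (sum_digit_sums b (b * n + c))
    = 2 * real b * real (sum_digit_sums b n) + real n * real b * (real b - 1)
      + 2 * real c * real (digit_sum b n) + real c * (real c - 1)"
proof -
  have "2 * real (sum_digit_sums b (b * n))
      = 2 * real b * real (sum_digit_sums b n) + real n * real b * (real b - 1)"
  proof (induction n)
    case 0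
    then show ?case by (simp add: sum_digit_sums_def)
  next
    case (Suc n)
    then show ?case
      using sum_digit_sums_append_aux[OF assms(1) order_refl, of n]
      by (simp add: sum_digit_sums_Suc algebra_simps)
  qed
  then show ?thesis using sum_digit_sums_append_aux[OF assms, of n] by simp
qed

lemma nu_append:
  assumes "b \<ge> 2" "c < b"
  shows "nu b (b * n + c) = real b * nu b n + real b * real n - real (digit_sum b n)
    + real c * (real (digit_sum b n) - real b * real n) / (real b - 1)"
proof -
  let ?B = "real b" and ?S = "real (sum_digit_sums b n)" and ?d = "real (digit_sum b n)"
  have B: "?B - 1 \<noteq> 0" and c: "c \<le> b" using assms by simp_all
  have "2 * real (sum_digit_sums b (b * n + c))
      - (real (b * n + c) - 1) * real (digit_sum b (b * n + c))
      = ?B * (2 * ?S - (real n - 1) * ?d) + (?B * real n - ?d) * (?B - 1)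
        + real c * (?d - ?B * real n)"
    unfolding sum_digit_sums_append[OF assms(1) c] digit_sum_append[OF assms]
    by (simp add: algebra_simps)
  then show ?thesis
    unfolding nu_def using B by (simp add: add_divide_distrib)
qed

section \<open>The recursion for the digit expansion side\<close>

lemma sum_base_digits_eq_mod:
  "(\<Sum>u=0..j. real (base_digit b n u) * real b ^ u) = real (n mod b ^ Suc j)"
proof -
  have "(\<Sum>u=0..j. real (base_digit b n u) * real b ^ u)
      = real (\<Sum>u<Suc j. base_digit b n u * b ^ u)"
    by (simp add: atLeast0AtMost lessThan_Suc_atMost)
  then show ?thesis by (simp only: sum_base_digits_lessThan)
qed

lemma sum_high_base_digits_eq_div:
  assumes "n < b ^ Suc k" "j \<le> k"
  shows "(\<Sum>v=j+1..k. real (base_digit b n v) * real b ^ v)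
    = real b ^ Suc j * real (n div b ^ Suc j)"
proof -
  let ?f = "\<lambda>v. real (base_digit b n v) * real b ^ v"
  have "sum ?f {0..j} + sum ?f {j+1..k} = sum ?f {0..k}"
    using sum.ub_add_nat[of 0 j ?f "k - j"] assms(2) by simp
  moreover have "real n = real b ^ Suc j * real (n div b ^ Suc j) + real (n mod b ^ Suc j)"
    by (metis mult_div_mod_eq of_nat_add of_nat_mult of_nat_power)
  ultimately show ?thesis
    using assms(1) by (simp only: sum_base_digits_eq_mod mod_less)
qed

text \<open>The summands vanish beyond the leading digit, and the first two vanish at index \<open>0\<close>, so
  all three sums may run over the same range, of any sufficient length \<open>L\<close>.\<close>

lemma nu_star_eq:
  assumes "b \<ge> 2" "lead_index b n < L"
  shows "nu_star b n = (\<Sum>j<L. real j * real (base_digit b n j) * real b ^ j)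
    - ((\<Sum>j<L. real (base_digit b n j) * ((real b ^ j - 1) / (real b - 1)))
      + (\<Sum>j<L. real (n mod b ^ Suc j) * real (n div b ^ Suc j)))"
proof -
  let ?k = "lead_index b n"
  have nk: "n < b ^ Suc ?k" by (rule less_power_Suc_lead_index[OF assms(1)])
  have less: "n < b ^ j" if "?k < j" for j
  proof -
    have "b ^ Suc ?k \<le> b ^ j" using that assms(1) by (intro power_increasing) auto
    with nk show ?thesis by simp
  qed
  have zero: "base_digit b n j = 0" "n div b ^ Suc j = 0" if "?k < j" for j
    using less[of j] less[of "Suc j"] that by (auto simp: base_digit_eq_0)
  have 1: "(\<Sum>j=1..?k. real j * real (base_digit b n j) * real b ^ j)
      = (\<Sum>j<L. real j * real (base_digit b n j) * real b ^ j)"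
    by (rule sum.mono_neutral_left) (use assms(2) zero(1) in \<open>auto simp: not_le\<close>)
  have 2: "(\<Sum>j=1..?k. real (base_digit b n j) * ((real b ^ j - 1) / (real b - 1)))
      = (\<Sum>j<L. real (base_digit b n j) * ((real b ^ j - 1) / (real b - 1)))"
  proof (rule sum.mono_neutral_left)
    show "\<forall>i\<in>{..<L} - {1..?k}.
        real (base_digit b n i) * ((real b ^ i - 1) / (real b - 1)) = 0"
    proof
      fix i assume "i \<in> {..<L} - {1..?k}"
      then have "i = 0 \<or> ?k < i" by auto
      then show "real (base_digit b n i) * ((real b ^ i - 1) / (real b - 1)) = 0"
        using zero(1) by auto
    qed
  qed (use assms(2) in auto)
  have "(\<Sum>j=0..?k. 1 / real b ^ (j + 1)
        * (\<Sum>u=0..j. real (base_digit b n u) * real b ^ u)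
        * (\<Sum>v=j+1..?k. real (base_digit b n v) * real b ^ v))
      = (\<Sum>j=0..?k. real (n mod b ^ Suc j) * real (n div b ^ Suc j))"
  proof (rule sum.cong[OF refl])
    fix j assume "j \<in> {0..?k}"
    then have j: "j \<le> ?k" by simp
    have "real b ^ Suc j \<noteq> 0" using assms(1) by simp
    then show "1 / real b ^ (j + 1)
        * (\<Sum>u=0..j. real (base_digit b n u) * real b ^ u)
        * (\<Sum>v=j+1..?k. real (base_digit b n v) * real b ^ v)
      = real (n mod b ^ Suc j) * real (n div b ^ Suc j)"
      unfolding sum_base_digits_eq_mod sum_high_base_digits_eq_div[OF nk j]
      by (simp del: power_Suc)
  qed
  also have "\<dots> = (\<Sum>j<L. real (n mod b ^ Suc j) * real (n div b ^ Suc j))"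
    by (rule sum.mono_neutral_left)
      (use assms(2) zero(2) in \<open>auto simp: not_le simp del: power_Suc\<close>)
  finally show ?thesis
    unfolding nu_star_def Let_def 1 2 by simp
qed

text \<open>Appending \<open>c\<close> shifts all digits by one place. The three sums of \<open>nu_star\<close> get multiplied by
  \<open>b\<close>, up to error terms: the number \<open>b * n\<close> in the first, the digit sum in the second, and in
  the third the term \<open>c * n\<close> of index \<open>0\<close> together with the sum from Legendre's formula.\<close>

lemma nu_star_append:
  assumes "b \<ge> 2" "c < b"
  shows "nu_star b (b * n + c) = real b * nu_star b n + real b * real n - real (digit_sum b n)
    + real c * (real (digit_sum b n) - real b * real n) / (real b - 1)"
proof -
  let ?N = "b * n + c" and ?B = "real b" and ?a = "\<lambda>j. real (base_digit b n j)"
  let ?q = "\<lambda>j. real (n div b ^ Suc j)" and ?r = "\<lambda>j. real (n mod b ^ Suc j)"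
  define L where "L = Suc (lead_index b n)"
  have B: "?B - 1 \<noteq> 0" using assms by simp
  have nL: "n < b ^ L" unfolding L_def by (rule less_power_Suc_lead_index[OF assms(1)])
  have "floorlog b ?N \<le> Suc L"
    using append_less_power_Suc[OF assms(2) nL] floorlog_le_iff_less_power[OF assms(1)] by blast
  then have lead: "lead_index b ?N < Suc L" unfolding lead_index_def by simp
  have digit: "base_digit b ?N (Suc j) = base_digit b n j" for j
    by (rule base_digit_append_Suc[OF assms(2)])

  have n_eq: "(\<Sum>j<L. ?a j * ?B ^ j) = real n"
    using sum_base_digits_eq_mod[where j="lead_index b n" and b=b and n=n] nL
    by (simp add: L_def atLeast0AtMost lessThan_Suc_atMost)
  have 1: "(\<Sum>j<Suc L. real j * real (base_digit b ?N j) * ?B ^ j)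
      = ?B * (\<Sum>j<L. real j * ?a j * ?B ^ j) + ?B * real n"
  proof -
    have "(\<Sum>j<Suc L. real j * real (base_digit b ?N j) * ?B ^ j)
        = (\<Sum>j<L. ?B * (real j * ?a j * ?B ^ j) + ?B * (?a j * ?B ^ j))"
      by (subst sum.lessThan_Suc_shift) (simp only: digit, simp add: algebra_simps)
    then show ?thesis by (simp only: sum.distrib flip: sum_distrib_left n_eq)
  qed
  have 2: "(\<Sum>j<Suc L. real (base_digit b ?N j) * ((?B ^ j - 1) / (?B - 1)))
      = ?B * (\<Sum>j<L. ?a j * ((?B ^ j - 1) / (?B - 1))) + real (digit_sum b n)"
  proof -
    have step: "(?B ^ Suc j - 1) / (?B - 1) = ?B * ((?B ^ j - 1) / (?B - 1)) + 1" for j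
      using B by (simp add: field_simps)
    have "(\<Sum>j<Suc L. real (base_digit b ?N j) * ((?B ^ j - 1) / (?B - 1)))
        = (\<Sum>j<L. ?a j * ((?B ^ Suc j - 1) / (?B - 1)))"
      by (subst sum.lessThan_Suc_shift) (simp add: digit)
    also have "\<dots> = (\<Sum>j<L. ?B * (?a j * ((?B ^ j - 1) / (?B - 1))) + ?a j)"
      unfolding step by (simp add: algebra_simps)
    also have "\<dots> = ?B * (\<Sum>j<L. ?a j * ((?B ^ j - 1) / (?B - 1))) + (\<Sum>j<L. ?a j)"
      by (simp only: sum.distrib sum_distrib_left)
    finally show ?thesis by (simp add: digit_sum_eq[OF assms(1) nL])
  qed
  have 3: "(\<Sum>j<Suc L. real (?N mod b ^ Suc j) * real (?N div b ^ Suc j))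
      = real c * real n + ?B * (\<Sum>j<L. ?r j * ?q j) + real c * (\<Sum>j<L. ?q j)"
  proof -
    have "(\<Sum>j<Suc L. real (?N mod b ^ Suc j) * real (?N div b ^ Suc j))
        = (\<Sum>j<Suc L. (?B * real (n mod b ^ j) + real c) * real (n div b ^ j))"
      unfolding mod_power_Suc_append[OF assms(2)] div_power_Suc_append[OF assms(2)] by simp
    also have "\<dots> = real c * real n + (\<Sum>j<L. (?B * ?r j + real c) * ?q j)"
      by (subst sum.lessThan_Suc_shift) simp
    also have "(\<Sum>j<L. (?B * ?r j + real c) * ?q j)
        = (\<Sum>j<L. ?B * (?r j * ?q j) + real c * ?q j)"
      by (simp only: distrib_right mult.assoc)
    finally show ?thesis by (simp only: sum.distrib sum_distrib_left add.assoc)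
  qed
  have leg: "(\<Sum>j<L. ?q j) = (real n - real (digit_sum b n)) / (?B - 1)"
    using legendre_digit_sum[OF assms(1) nL] B by (simp add: eq_divide_eq mult.commute)
  have star: "nu_star b n = (\<Sum>j<L. real j * ?a j * ?B ^ j)
      - ((\<Sum>j<L. ?a j * ((?B ^ j - 1) / (?B - 1))) + (\<Sum>j<L. ?r j * ?q j))"
    by (rule nu_star_eq[OF assms(1)]) (simp add: L_def)
  have frac: "real c * real n + real c * ((real n - real (digit_sum b n)) / (?B - 1))
      = - (real c * (real (digit_sum b n) - ?B * real n) / (?B - 1))"
    using B by (simp add: field_simps)
  show ?thesis
    unfolding nu_star_eq[OF assms(1) lead] 1 2 3 leg star
    using frac by (simp only: right_diff_distrib distrib_left)
qed

section \<open>Equality of the two functions\<close>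

theorem theorem10p1:
  fixes b :: nat
  assumes "b \<ge> 2"
  shows "\<forall>n\<ge>1. nu b n = nu_star b n"
proof -
  have "nu b n = nu_star b n" for n
  proof (induction n rule: less_induct)
    case (less n)
    show ?case
    proof (cases "n = 0")
      case True
      then show ?thesis
        by (simp add: nu_def nu_star_def sum_digit_sums_def digit_sum_def
            lead_index_def floorlog_def base_digit_def)
    next
      case False
      have n: "n = b * (n div b) + n mod b" by simp
      have "n mod b < b" and "n div b < n" using assms False by simp_all
      then show ?thesis
        by (subst (1 2) n) (simp only: nu_append[OF assms] nu_star_append[OF assms] less.IH)
    qed
  qed
  then show ?thesis by blast
qed

end
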